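(* Consider the hybrid system $\dot x\in F(t,x)$ for $x\in C$, $x^+\in G(x)$ for $x\in D$, satisfying Assumption A and Assumption B of the context, and let $\bar k>0$ be the minimum integer $k>0$ for which $G^{k}(D)\cap D=\emptyset$. Let $$\mathcal A=\Big\{\begin{pmatrix}z_x\\ z_y\end{pmatrix}\in (C\cup D)^2\ \Big|\ \exists k_1,k_2\in\{0,1,\ldots,\bar k\}:\ G^{k_1}(z_x)\cap G^{k_2}(z_y)\neq\emptyset\Big\}$$ and let $d:(C\cup D)^2\to\mathbb R_{\ge 0}$ be $$d(x,y)=\inf_{z\in\mathcal A}\left\|\begin{pmatrix}x\\ y\end{pmatrix}-z\right\|.$$ Then $d$ is continuous and satisfies: 1) for $x,y\in C\cup D$, $d(x,y)=0$ if and only if there exist $k_1,k_2\in\{0,1,\ldots,\bar k\}$ such that $G^{k_1}(x)\cap G^{k_2}(y)\neq\emptyset$; 2) the set $\{y\in C\cup D\mid d(x,y)<\beta\}$ is bounded for all $x\in C\cup D$ and all $\beta>0$; 3) $d(x,y)=d(y,x)$ for all $x,y\in C\cup D$. In addition, the set $\mathcal A$ is closed.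
   Context: **Data.** $C,D\subseteq\mathbb R^n$, $F:[0,\infty)\times C\rightrightarrows\mathbb R^n$ and $G:D\rightrightarrows\mathbb R^n$ are set-valued maps. For a set $S$, $G(S)=\{y\mid y\in G(x)\text{ for some }x\in S\cap D\}$; in particular $G(y)=\emptyset$ for $y\notin D$. $G^0(x)=\{x\}$ for all $x\in\mathbb R^n$ and $G^k(x)=G(G^{k-1}(x))$ for $k\ge1$. $\|\cdot\|$ is the Euclidean norm and $\mathbb B$ the closed unit ball. A set-valued map is outer semicontinuous if its graph is closed, and locally bounded if it maps each compact subset of its domain to a bounded set. An outer semicontinuous map $G:D\rightrightarrows\mathbb R^n$ is proper if for every sequence $(x_m,y_m)$ with $y_m\in G(x_m)$ and $y_m$ convergent in $\mathbb R^n$, there is a point $(\bar x,\bar y)\in D\times\mathbb R^n$ to which a subsequence of $(x_m,y_m)$ converges. **Solutions.** Let $t_0\ge 0$ be the initial time. A compact hybrid time domain is a set $\bigcup_{j=0}^{J-1}([t_j,t_{j+1}]\times\{j\})$ for a finite sequence $t_0\le t_1\le\dots\le t_J$; a set $E\subset[t_0,\infty)\times\mathbb N$ is a hybrid time domain if for all $(T,J)\in E$, $E\cap([t_0,T]\times\{0,\ldots,J\})$ is a compact hybrid time domain. A solution is a function $\varphi:\mathrm{dom}\,\varphi\to\mathbb R^n$ on a hybrid time domain such that, for each fixed $j$, $t\mapsto\varphi(t,j)$ is locally absolutely continuous; $\varphi(t,j)\in D$ and $\varphi(t,j+1)\in G(\varphi(t,j))$ whenever $(t,j),(t,j+1)\in\mathrm{dom}\,\varphi$;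 and $\varphi(t,j)\in C$, $\frac{d}{dt}\varphi(t,j)\in\bar F(t,\varphi(t,j))$ for almost all $t\in I_j=\{t\mid(t,j)\in\mathrm{dom}\,\varphi\}$ and all $j$ such that $I_j$ has nonempty interior, where $\bar F(t,x)=\bigcap_{\delta>0}\mathrm{co}\,F(t,(x+\delta\mathbb B)\cap C)$ and $\mathrm{co}$ is the closed convex hull. A solution is maximal if it cannot be extended to a solution on a strictly larger hybrid time domain. A hybrid time domain is unbounded in $t$-direction if for each $T\ge0$ (with $T\ge t_0$) it contains $(T,j)$ for some $j$. **Assumption A.** (i) $C,D$ are closed and $C\cup D\ne\emptyset$; (ii) $F(t,x)$ is non-empty for all $(t,x)\in[t_0,\infty)\times C$, $F$ is measurable, and for each bounded closed set $S\subset[t_0,\infty)\times C$ there is an almost everywhere finite function $m(t)$ such that $\|f\|\le m(t)$ for all $f\in F(t,x)$ and almost all $(t,x)\in S$; (iii) $G:D\rightrightarrows\mathbb R^n$ has nonempty values and is outer semicontinuous and locally bounded. **Assumption B.** $G$ is proper; there is an integer $k>0$ with $G^{k}(D)\cap D=\emptyset$; and every maximal solution has a hybrid time domain that is unbounded in $t$-direction. *)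

theory Defs
  imports "HOL-Analysis.Analysis"
begin

text \<open>
  A set-valued map with domain \<open>D\<close> is a total function \<open>G :: 'a \<Rightarrow> 'b set\<close> together with \<open>D\<close>;
  its values outside \<open>D\<close> never enter any of the definitions below.
\<close>

definition svm_graph :: "'a set \<Rightarrow> ('a \<Rightarrow> 'b set) \<Rightarrow> ('a \<times> 'b) set" where
  "svm_graph D G = {(x, y). x \<in> D \<and> y \<in> G x}"

definition svm_image :: "'a set \<Rightarrow> ('a \<Rightarrow> 'b set) \<Rightarrow> 'a set \<Rightarrow> 'b set" where
  "svm_image D G S = {y. \<exists>x \<in> S \<inter> D. y \<in> G x}"

text \<open>
  Iterates act on sets: \<open>G\<^sup>k(x)\<close> is \<open>svm_iter D G k {x}\<close>. In particular \<open>G\<^sup>0(x) = {x}\<close> also for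
  \<open>x\<close> outside \<open>D\<close>.
\<close>

definition svm_iter :: "'a set \<Rightarrow> ('a \<Rightarrow> 'a set) \<Rightarrow> nat \<Rightarrow> 'a set \<Rightarrow> 'a set" where
  "svm_iter D G k S = (svm_image D G ^^ k) S"

definition outer_semicontinuous ::
    "'a::topological_space set \<Rightarrow> ('a \<Rightarrow> 'b::topological_space set) \<Rightarrow> bool" where
  "outer_semicontinuous D G \<longleftrightarrow> closed (svm_graph D G)"

definition svm_locally_bounded ::
    "'a::topological_space set \<Rightarrow> ('a \<Rightarrow> 'b::metric_space set) \<Rightarrow> bool" where
  "svm_locally_bounded D G \<longleftrightarrow> (\<forall>K. compact K \<and> K \<subseteq> D \<longrightarrow> bounded (svm_image D G K))"

definition svm_proper ::
    "'a::topological_space set \<Rightarrow> ('a \<Rightarrow> 'b::topological_space set) \<Rightarrow> bool" where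
  "svm_proper D G \<longleftrightarrow>
     (\<forall>x y. (\<forall>m::nat. x m \<in> D \<and> y m \<in> G (x m)) \<and> convergent y \<longrightarrow>
        (\<exists>xb \<in> D. \<exists>yb. \<exists>r::nat \<Rightarrow> nat. strict_mono r \<and> (\<lambda>m. (x (r m), y (r m))) \<longlonglongrightarrow> (xb, yb)))"

text \<open>
  Measurability is understood in the sense of weak (open-set) measurability with respect to Lebesgue
  measure; the values need not be closed.
\<close>

definition svm_measurable ::
    "'a::euclidean_space set \<Rightarrow> ('a \<Rightarrow> 'b::topological_space set) \<Rightarrow> bool" where
  "svm_measurable X F \<longleftrightarrow> (\<forall>U. open U \<longrightarrow> {x \<in> X. F x \<inter> U \<noteq> {}} \<in> sets lebesgue)"

text \<open>
  Absolute continuity in the \<open>\<epsilon>\<close>-\<open>\<delta>\<close> sense; the finite families of non-overlapping intervals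
  \<open>[a\<^sub>i, b\<^sub>i]\<close> are given by \<open>division_of\<close>, with \<open>Inf K = a\<^sub>i\<close> and \<open>Sup K = b\<^sub>i\<close>.
\<close>

definition abs_continuous_on :: "real set \<Rightarrow> (real \<Rightarrow> 'a::real_normed_vector) \<Rightarrow> bool" where
  "abs_continuous_on S f \<longleftrightarrow>
     (\<forall>\<epsilon>>0. \<exists>\<delta>>0. \<forall>\<D>. \<D> division_of \<Union>\<D> \<and> \<Union>\<D> \<subseteq> S \<and> (\<Sum>K\<in>\<D>. Sup K - Inf K) < \<delta> \<longrightarrow>
        (\<Sum>K\<in>\<D>. norm (f (Sup K) - f (Inf K))) < \<epsilon>)"

definition locally_abs_continuous_on ::
    "real set \<Rightarrow> (real \<Rightarrow> 'a::real_normed_vector) \<Rightarrow> bool" where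
  "locally_abs_continuous_on S f \<longleftrightarrow> (\<forall>a b. {a..b} \<subseteq> S \<longrightarrow> abs_continuous_on {a..b} f)"

definition compact_hybrid_time_domain :: "real \<Rightarrow> (real \<times> nat) set \<Rightarrow> bool" where
  "compact_hybrid_time_domain t0 E \<longleftrightarrow>
     (\<exists>J::nat. \<exists>\<tau>::nat \<Rightarrow> real. \<tau> 0 = t0 \<and> (\<forall>j<J. \<tau> j \<le> \<tau> (Suc j)) \<and>
        E = (\<Union>j<J. {\<tau> j..\<tau> (Suc j)} \<times> {j}))"

definition hybrid_time_domain :: "real \<Rightarrow> (real \<times> nat) set \<Rightarrow> bool" where
  "hybrid_time_domain t0 E \<longleftrightarrow>
     E \<subseteq> {t0..} \<times> UNIV \<and>
     (\<forall>(T, J) \<in> E. compact_hybrid_time_domain t0 (E \<inter> ({t0..T} \<times> {0..J})))"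

definition flow_times :: "(real \<times> nat) set \<Rightarrow> nat \<Rightarrow> real set" where
  "flow_times E j = {t. (t, j) \<in> E}"

definition unbounded_in_t :: "real \<Rightarrow> (real \<times> nat) set \<Rightarrow> bool" where
  "unbounded_in_t t0 E \<longleftrightarrow> (\<forall>T. T \<ge> 0 \<and> T \<ge> t0 \<longrightarrow> (\<exists>j. (T, j) \<in> E))"

definition regularized ::
    "'a::real_normed_vector set \<Rightarrow> (real \<Rightarrow> 'a \<Rightarrow> 'a set) \<Rightarrow> real \<Rightarrow> 'a \<Rightarrow> 'a set" where
  "regularized C F t x = (\<Inter>\<delta>\<in>{0<..}. closure (convex hull (\<Union>y\<in>cball x \<delta> \<inter> C. F t y)))"

text \<open>
  A hybrid arc is a pair of a domain \<open>E\<close> and a function \<open>\<phi>\<close> whose values outside \<open>E\<close> are irrelevant.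
  The derivative is taken relative to the interval of flow, which makes no difference at its interior
  points.
\<close>

definition hybrid_solution ::
    "real \<Rightarrow> 'a::euclidean_space set \<Rightarrow> 'a set \<Rightarrow> (real \<Rightarrow> 'a \<Rightarrow> 'a set) \<Rightarrow> ('a \<Rightarrow> 'a set) \<Rightarrow>
     (real \<times> nat) set \<Rightarrow> (real \<Rightarrow> nat \<Rightarrow> 'a) \<Rightarrow> bool" where
  "hybrid_solution t0 C D F G E \<phi> \<longleftrightarrow>
     hybrid_time_domain t0 E \<and>
     (\<forall>j. locally_abs_continuous_on (flow_times E j) (\<lambda>t. \<phi> t j)) \<and>
     (\<forall>t j. (t, j) \<in> E \<and> (t, Suc j) \<in> E \<longrightarrow> \<phi> t j \<in> D \<and> \<phi> t (Suc j) \<in> G (\<phi> t j)) \<and>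
     (\<forall>j. interior (flow_times E j) \<noteq> {} \<longrightarrow>
        (AE t in lebesgue. t \<in> flow_times E j \<longrightarrow>
           \<phi> t j \<in> C \<and>
           (\<exists>v \<in> regularized C F t (\<phi> t j).
              ((\<lambda>s. \<phi> s j) has_vector_derivative v) (at t within flow_times E j))))"

definition maximal_hybrid_solution ::
    "real \<Rightarrow> 'a::euclidean_space set \<Rightarrow> 'a set \<Rightarrow> (real \<Rightarrow> 'a \<Rightarrow> 'a set) \<Rightarrow> ('a \<Rightarrow> 'a set) \<Rightarrow>
     (real \<times> nat) set \<Rightarrow> (real \<Rightarrow> nat \<Rightarrow> 'a) \<Rightarrow> bool" where
  "maximal_hybrid_solution t0 C D F G E \<phi> \<longleftrightarrow>
     hybrid_solution t0 C D F G E \<phi> \<and>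
     \<not> (\<exists>E' \<phi>'. E \<subset> E' \<and> hybrid_solution t0 C D F G E' \<phi>' \<and> (\<forall>(t, j) \<in> E. \<phi>' t j = \<phi> t j))"

definition assumption_A ::
    "real \<Rightarrow> 'a::euclidean_space set \<Rightarrow> 'a set \<Rightarrow> (real \<Rightarrow> 'a \<Rightarrow> 'a set) \<Rightarrow> ('a \<Rightarrow> 'a set) \<Rightarrow> bool" where
  "assumption_A t0 C D F G \<longleftrightarrow>
     closed C \<and> closed D \<and> C \<union> D \<noteq> {} \<and>
     (\<forall>t\<ge>t0. \<forall>x\<in>C. F t x \<noteq> {}) \<and>
     svm_measurable ({0..} \<times> C) (\<lambda>(t, x). F t x) \<and>
     (\<forall>S. bounded S \<and> closed S \<and> S \<subseteq> {t0..} \<times> C \<longrightarrow>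
        (\<exists>m::real \<Rightarrow> ereal. (AE t in lebesgue. \<bar>m t\<bar> \<noteq> \<infinity>) \<and>
           (AE p in lebesgue. p \<in> S \<longrightarrow> (\<forall>f \<in> F (fst p) (snd p). ereal (norm f) \<le> m (fst p))))) \<and>
     (\<forall>x\<in>D. G x \<noteq> {}) \<and> outer_semicontinuous D G \<and> svm_locally_bounded D G"

text \<open>
  Maximal solutions are required to be unbounded when they start in \<open>C \<union> D\<close>. A point outside the
  closed set \<open>C \<union> D\<close> carries only the solution with domain \<open>{(t0, 0)}\<close>, which is maximal, so
  including such initial points would force \<open>C \<union> D\<close> to be the whole space.
\<close>

definition assumption_B ::
    "real \<Rightarrow> 'a::euclidean_space set \<Rightarrow> 'a set \<Rightarrow> (real \<Rightarrow> 'a \<Rightarrow> 'a set) \<Rightarrow> ('a \<Rightarrow> 'a set) \<Rightarrow> bool" where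
  "assumption_B t0 C D F G \<longleftrightarrow>
     svm_proper D G \<and>
     (\<exists>k>0. svm_iter D G k D \<inter> D = {}) \<and>
     (\<forall>E \<phi>. maximal_hybrid_solution t0 C D F G E \<phi> \<and> (t0, 0) \<in> E \<and> \<phi> t0 0 \<in> C \<union> D \<longrightarrow>
        unbounded_in_t t0 E)"

definition min_jumps :: "'a set \<Rightarrow> ('a \<Rightarrow> 'a set) \<Rightarrow> nat" where
  "min_jumps D G = (LEAST k. k > 0 \<and> svm_iter D G k D \<inter> D = {})"

definition jump_related :: "'a set \<Rightarrow> ('a \<Rightarrow> 'a set) \<Rightarrow> 'a \<Rightarrow> 'a \<Rightarrow> bool" where
  "jump_related D G x y \<longleftrightarrow>
     (\<exists>k1 \<in> {0..min_jumps D G}. \<exists>k2 \<in> {0..min_jumps D G}.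
        svm_iter D G k1 {x} \<inter> svm_iter D G k2 {y} \<noteq> {})"

definition hybrid_diagonal :: "'a set \<Rightarrow> 'a set \<Rightarrow> ('a \<Rightarrow> 'a set) \<Rightarrow> ('a \<times> 'a) set" where
  "hybrid_diagonal C D G = {(zx, zy) \<in> (C \<union> D) \<times> (C \<union> D). jump_related D G zx zy}"

text \<open>
  The norm on \<open>'a \<times> 'a\<close> is the Euclidean norm of the stacked vector.
\<close>

definition hybrid_dist ::
    "'a::real_normed_vector set \<Rightarrow> 'a set \<Rightarrow> ('a \<Rightarrow> 'a set) \<Rightarrow> 'a \<Rightarrow> 'a \<Rightarrow> real" where
  "hybrid_dist C D G x y = (INF z \<in> hybrid_diagonal C D G. norm ((x, y) - z))"

end

theory Submission
  imports Defs
begin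

text \<open>
  Identify a set-valued map with its graph \<open>r\<close>. The \<open>k\<close>-th iterate of the map then is the relational
  power \<open>r ^^ k\<close>, and two points are jump related iff they are related by one of the finitely many
  relations \<open>r ^^ k1 O (r\<inverse>) ^^ k2\<close>: jump forward \<open>k1\<close> times, then backward \<open>k2\<close> times.

  The theorem is about relations that are closed and send compact sets to bounded sets. This class
  contains the identity and is closed under composition and finite unions
  (\<open>tame_relcomp\<close>, \<open>tame_finite_Union\<close>). The graph \<open>r\<close> belongs to it because \<open>G\<close> is outer
  semicontinuous and locally bounded; the converse \<open>r\<inverse>\<close> belongs to it because \<open>G\<close> is proper, since
  properness keeps points whose images converge from escaping to infinity. Hence the
  jump relation belongs to the class as well.

  All claims follow. The diagonal set is closed, being the jump relation restricted to a closed set;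
  so the distance to it is continuous and vanishes exactly on it. If \<open>d(x, y) < \<beta>\<close>, then \<open>y\<close> is
  within \<open>\<beta>\<close> of the image of the compact ball of radius \<open>\<beta>\<close> about \<open>x\<close> under the jump relation, and
  that image is bounded. Symmetry comes from the symmetry of the jump relation.
\<close>

section \<open>Closed relations that are bounded on compact sets\<close>

definition tame_relation :: "('a::metric_space \<times> 'b::metric_space) set \<Rightarrow> bool" where
  "tame_relation r \<longleftrightarrow> closed r \<and> (\<forall>K. compact K \<longrightarrow> bounded (r `` K))"

lemma tame_Id: "tame_relation (Id :: ('a::metric_space \<times> 'a) set)"
proof -
  have "closed {p :: 'a \<times> 'a. fst p = snd p}"
    by (intro closed_Collect_eq continuous_intros)
  moreover have "{p :: 'a \<times> 'a. fst p = snd p} = Id"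
    by auto
  ultimately show ?thesis
    by (simp add: tame_relation_def compact_imp_bounded)
qed

lemma tame_compact_Image:
  fixes r :: "('a::metric_space \<times> 'b::heine_borel) set"
  assumes "tame_relation r" "compact K"
  shows "compact (r `` K)"
proof -
  have bdd: "bounded (r `` K)"
    using assms by (simp add: tame_relation_def)
  have "compact (K \<times> closure (r `` K))"
    using assms(2) bdd by (intro compact_Times) (simp_all add: compact_closure)
  then have "compact (snd ` (r \<inter> (K \<times> closure (r `` K))))"
    using assms(1)
    by (intro compact_continuous_image continuous_intros closed_Int_compact)
      (simp_all add: tame_relation_def)
  moreover have "snd ` (r \<inter> (K \<times> closure (r `` K))) = r `` K"
  proof
    show "r `` K \<subseteq> snd ` (r \<inter> (K \<times> closure (r `` K)))"
    proof
      fix y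
      assume y: "y \<in> r `` K"
      then obtain x where "(x, y) \<in> r \<inter> (K \<times> closure (r `` K))"
        using closure_subset[of "r `` K"] by blast
      then show "y \<in> snd ` (r \<inter> (K \<times> closure (r `` K)))"
        by (rule image_eqI[rotated]) simp
    qed
  qed auto
  ultimately show ?thesis
    by simp
qed

text \<open>
  A composition of closed relations need not be closed, since the intermediate points may escape to
  infinity. Boundedness of the first relation on compact sets keeps them in a compact set.
\<close>

lemma tame_relcomp:
  fixes r :: "('a::heine_borel \<times> 'b::heine_borel) set"
    and s :: "('b \<times> 'c::metric_space) set"
  assumes r: "tame_relation r" and s: "tame_relation s"
  shows "tame_relation (r O s)"
proof -
  have "closed (r O s)"
    unfolding closed_sequential_limits
  proof (intro allI impI, elim conjE)
    fix p :: "nat \<Rightarrow> 'a \<times> 'c" and l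
    assume p: "\<forall>n. p n \<in> r O s" and lim: "p \<longlonglongrightarrow> l"
    have "\<forall>n. \<exists>y. (fst (p n), y) \<in> r \<and> (y, snd (p n)) \<in> s"
      using p by (metis prod.collapse relcompEpair)
    then obtain y where y: "\<And>n. (fst (p n), y n) \<in> r" "\<And>n. (y n, snd (p n)) \<in> s"
      by metis
    have fst_lim: "(\<lambda>n. fst (p n)) \<longlonglongrightarrow> fst l" and snd_lim: "(\<lambda>n. snd (p n)) \<longlonglongrightarrow> snd l"
      using lim by (auto intro: tendsto_fst tendsto_snd)
    have "seq_compact (r `` insert (fst l) (range (\<lambda>n. fst (p n))))"
      using tame_compact_Image[OF r compact_sequence_with_limit[OF fst_lim]]
      by (rule compact_imp_seq_compact)
    moreover have "\<forall>n. y n \<in> r `` insert (fst l) (range (\<lambda>n. fst (p n)))"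
      using y(1) by blast
    ultimately obtain y0 q where q: "strict_mono (q :: nat \<Rightarrow> nat)" "(y \<circ> q) \<longlonglongrightarrow> y0"
      by (rule seq_compactE)
    have "(\<lambda>n. (fst (p (q n)), y (q n))) \<longlonglongrightarrow> (fst l, y0)"
      using LIMSEQ_subseq_LIMSEQ[OF fst_lim q(1)] q(2) by (auto intro: tendsto_Pair simp: o_def)
    then have "(fst l, y0) \<in> r"
      by (rule closed_sequentially[rotated 2]) (use r y(1) in \<open>auto simp: tame_relation_def\<close>)
    moreover have "(\<lambda>n. (y (q n), snd (p (q n)))) \<longlonglongrightarrow> (y0, snd l)"
      using LIMSEQ_subseq_LIMSEQ[OF snd_lim q(1)] q(2) by (auto intro: tendsto_Pair simp: o_def)
    then have "(y0, snd l) \<in> s"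
      by (rule closed_sequentially[rotated 2]) (use s y(2) in \<open>auto simp: tame_relation_def\<close>)
    ultimately show "l \<in> r O s"
      by (metis prod.collapse relcomp.relcompI)
  qed
  moreover have "bounded ((r O s) `` K)" if "compact K" for K
    using tame_compact_Image[OF r that] s by (simp add: tame_relation_def relcomp_Image)
  ultimately show ?thesis
    by (simp add: tame_relation_def)
qed

lemma tame_relpow:
  fixes r :: "('a::heine_borel \<times> 'a) set"
  assumes "tame_relation r"
  shows "tame_relation (r ^^ k)"
  by (induction k) (simp_all add: tame_Id tame_relcomp assms)

lemma tame_finite_Union:
  assumes "finite I" "\<And>i. i \<in> I \<Longrightarrow> tame_relation (r i)"
  shows "tame_relation (\<Union>i\<in>I. r i)"
proof -
  have "(\<Union>i\<in>I. r i) `` K = (\<Union>i\<in>I. r i `` K)" for K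
    by blast
  then show ?thesis
    using assms by (auto simp: tame_relation_def intro!: closed_UN bounded_UN)
qed

section \<open>The jump relation\<close>

lemma svm_iter_eq_Image: "svm_iter D G k S = (svm_graph D G ^^ k) `` S"
proof (induction k)
  case (Suc k)
  have "svm_iter D G (Suc k) S = svm_graph D G `` svm_iter D G k S"
    by (auto simp: svm_iter_def svm_image_def svm_graph_def)
  then show ?case
    by (simp add: Suc relcomp_Image)
qed (simp add: svm_iter_def)

lemma tame_svm_graph:
  assumes "closed D" "outer_semicontinuous D G" "svm_locally_bounded D G"
  shows "tame_relation (svm_graph D G)"
  unfolding tame_relation_def
proof (intro conjI allI impI)
  show "closed (svm_graph D G)"
    using assms(2) by (simp add: outer_semicontinuous_def)
  fix K :: "'a set"
  assume "compact K"
  then have "bounded (svm_image D G (K \<inter> D))"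
    using assms(1,3) by (simp add: svm_locally_bounded_def compact_Int_closed)
  moreover have "svm_graph D G `` K = svm_image D G (K \<inter> D)"
    by (auto simp: svm_graph_def svm_image_def)
  ultimately show "bounded (svm_graph D G `` K)"
    by simp
qed

text \<open>
  Properness makes preimages of compact sets sequentially compact: the images of a sequence in the
  preimage subconverge, so the sequence itself does, and closedness of the graph keeps the limit in
  the preimage.
\<close>

lemma tame_converse_svm_graph:
  fixes G :: "'a::metric_space \<Rightarrow> 'b::metric_space set"
  assumes "outer_semicontinuous D G" "svm_proper D G"
  shows "tame_relation ((svm_graph D G)\<inverse>)"
  unfolding tame_relation_def
proof (intro conjI allI impI)
  have closed_graph: "closed (svm_graph D G)"
    using assms(1) by (simp add: outer_semicontinuous_def)
  have "closed ((\<lambda>p. (snd p, fst p)) -` svm_graph D G)"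
    by (intro closed_vimage closed_graph continuous_intros)
  moreover have "(\<lambda>p. (snd p, fst p)) -` svm_graph D G = (svm_graph D G)\<inverse>"
    by auto
  ultimately show "closed ((svm_graph D G)\<inverse>)"
    by simp
  fix K :: "'b set"
  assume K: "compact K"
  have "compact ((svm_graph D G)\<inverse> `` K)"
    unfolding compact_def
  proof (intro allI impI)
    fix x :: "nat \<Rightarrow> 'a"
    assume "\<forall>n. x n \<in> (svm_graph D G)\<inverse> `` K"
    then obtain y where y: "\<And>n. y n \<in> K" "\<And>n. (x n, y n) \<in> svm_graph D G"
      unfolding Image_iff converse_iff by metis
    obtain y0 q where q: "y0 \<in> K" "strict_mono (q :: nat \<Rightarrow> nat)" "(y \<circ> q) \<longlonglongrightarrow> y0"
      using K y(1) unfolding compact_def by metis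
    have "\<forall>n. (x \<circ> q) n \<in> D \<and> (y \<circ> q) n \<in> G ((x \<circ> q) n)"
      using y(2) by (auto simp: svm_graph_def)
    moreover have "convergent (y \<circ> q)"
      using q(3) by (auto simp: convergent_def)
    ultimately obtain x1 y1 q' where q': "strict_mono (q' :: nat \<Rightarrow> nat)"
        "(\<lambda>n. ((x \<circ> q) (q' n), (y \<circ> q) (q' n))) \<longlonglongrightarrow> (x1, y1)"
      using assms(2) unfolding svm_proper_def by metis
    have "(x1, y1) \<in> svm_graph D G"
      using closed_graph q'(2) y(2) unfolding closed_sequential_limits by fastforce
    moreover have "y1 = y0"
      using tendsto_snd[OF q'(2)] LIMSEQ_subseq_LIMSEQ[OF q(3) q'(1)]
      by (auto simp: o_def intro: LIMSEQ_unique)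
    ultimately have "x1 \<in> (svm_graph D G)\<inverse> `` K"
      using q(1) by auto
    moreover have "(x \<circ> (q \<circ> q')) \<longlonglongrightarrow> x1"
      using tendsto_fst[OF q'(2)] by (simp add: o_def)
    ultimately show "\<exists>l\<in>(svm_graph D G)\<inverse> `` K. \<exists>q. strict_mono q \<and> (x \<circ> q) \<longlonglongrightarrow> l"
      using strict_mono_o[OF q(2) q'(1)] by blast
  qed
  then show "bounded ((svm_graph D G)\<inverse> `` K)"
    by (rule compact_imp_bounded)
qed

lemma relpow_converse:
  fixes r :: "('a \<times> 'a) set"
  shows "(r\<inverse>) ^^ k = (r ^^ k)\<inverse>"
  by (induction k) (simp_all add: relpow_commute flip: converse_relcomp)

text \<open>
  Two sets of iterates meet iff some point is reached from \<open>x\<close> by jumping forward and leads to \<open>y\<close>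
  by jumping backward, so nonempty intersections turn into compositions with the converse.
\<close>

lemma jump_related_eq_Union:
  "{(x, y). jump_related D G x y} =
    (\<Union>(k1, k2) \<in> {0..min_jumps D G} \<times> {0..min_jumps D G}.
      (svm_graph D G ^^ k1) O ((svm_graph D G)\<inverse> ^^ k2))"
proof -
  have "p `` {x} \<inter> q `` {y} \<noteq> {} \<longleftrightarrow> (x, y) \<in> p O q\<inverse>" for p q :: "('a \<times> 'a) set" and x y
    by blast
  then show ?thesis
    by (simp add: jump_related_def svm_iter_eq_Image relpow_converse set_eq_iff Bex_def)
qed

lemma tame_jump_related:
  fixes G :: "'a::heine_borel \<Rightarrow> 'a set"
  assumes "closed D" "outer_semicontinuous D G" "svm_locally_bounded D G" "svm_proper D G"
  shows "tame_relation {(x, y). jump_related D G x y}"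
  unfolding jump_related_eq_Union
  using assms
  by (auto intro!: tame_finite_Union tame_relcomp tame_relpow tame_svm_graph
      tame_converse_svm_graph)

lemma jump_related_refl: "jump_related D G x x"
  by (auto simp: jump_related_def svm_iter_def intro!: bexI[of _ 0])

lemma jump_related_sym: "jump_related D G x y \<Longrightarrow> jump_related D G y x"
  by (auto simp: jump_related_def)

section \<open>The distance to the hybrid diagonal\<close>

lemma closed_hybrid_diagonal:
  fixes G :: "'a::heine_borel \<Rightarrow> 'a set"
  assumes "closed C" "closed D" "outer_semicontinuous D G" "svm_locally_bounded D G"
    "svm_proper D G"
  shows "closed (hybrid_diagonal C D G)"
proof -
  have "hybrid_diagonal C D G = (C \<union> D) \<times> (C \<union> D) \<inter> {(x, y). jump_related D G x y}"
    by (auto simp: hybrid_diagonal_def)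
  then show ?thesis
    using tame_jump_related[of D G] assms
    by (auto simp: tame_relation_def intro!: closed_Int closed_Times)
qed

lemma hybrid_diagonal_nonempty:
  assumes "C \<union> D \<noteq> {}"
  shows "hybrid_diagonal C D G \<noteq> {}"
proof -
  obtain x where "x \<in> C \<union> D"
    using assms by blast
  then have "(x, x) \<in> hybrid_diagonal C D G"
    by (simp add: hybrid_diagonal_def jump_related_refl)
  then show ?thesis
    by blast
qed

lemma hybrid_dist_eq_infdist:
  assumes "C \<union> D \<noteq> {}"
  shows "hybrid_dist C D G x y = infdist (x, y) (hybrid_diagonal C D G)"
  using hybrid_diagonal_nonempty[OF assms, of G]
  by (simp add: hybrid_dist_def infdist_notempty dist_norm)

text \<open>Exchanging the two components is an isometry that preserves the diagonal set.\<close>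

lemma hybrid_dist_commute: "hybrid_dist C D G x y = hybrid_dist C D G y x"
proof -
  have swap: "prod.swap ` hybrid_diagonal C D G = hybrid_diagonal C D G"
    using jump_related_sym by (force simp: hybrid_diagonal_def image_iff)
  have "norm ((x, y) - prod.swap z) = norm ((y, x) - z)" for z
    by (cases z) (simp add: norm_Pair add.commute)
  then have "(\<lambda>z. norm ((x, y) - z)) ` (prod.swap ` hybrid_diagonal C D G) =
      (\<lambda>z. norm ((y, x) - z)) ` hybrid_diagonal C D G"
    unfolding image_image by simp
  then show ?thesis
    by (simp add: hybrid_dist_def swap)
qed

lemma bounded_hybrid_dist_less:
  fixes G :: "'a::euclidean_space \<Rightarrow> 'a set"
  assumes "C \<union> D \<noteq> {}" "closed D" "outer_semicontinuous D G" "svm_locally_bounded D G"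
    "svm_proper D G"
  shows "bounded {y. hybrid_dist C D G x y < \<beta>}"
proof -
  have "bounded ({(u, v). jump_related D G u v} `` cball x \<beta>)"
    by (intro compact_imp_bounded tame_compact_Image tame_jump_related assms compact_cball)
  then have "\<exists>b. \<forall>v \<in> {(u, v). jump_related D G u v} `` cball x \<beta>. dist x v \<le> b"
    by (simp only: bounded_any_center[where a = x])
  then obtain b where b: "\<And>v. v \<in> {(u, v). jump_related D G u v} `` cball x \<beta> \<Longrightarrow> dist x v \<le> b"
    by blast
  have "dist x y \<le> b + \<beta>" if "hybrid_dist C D G x y < \<beta>" for y
  proof -
    have "(INF z \<in> hybrid_diagonal C D G. norm ((x, y) - z)) < \<beta>"
      using that by (simp add: hybrid_dist_def)
    then obtain z where z: "z \<in> hybrid_diagonal C D G" "dist (x, y) z < \<beta>"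
      using hybrid_diagonal_nonempty[OF assms(1), of G]
      by (auto simp: dist_norm dest!: cInf_lessD[rotated])
    obtain u v where uv: "z = (u, v)"
      by (cases z)
    have "dist x u < \<beta>" "dist y v < \<beta>"
      using z(2) dist_fst_le[of "(x, y)" z] dist_snd_le[of "(x, y)" z] by (simp_all add: uv)
    moreover have "jump_related D G u v"
      using z(1) by (simp add: uv hybrid_diagonal_def)
    ultimately have "dist x v \<le> b"
      by (intro b) auto
    then show ?thesis
      using \<open>dist y v < \<beta>\<close> dist_triangle2[of x y v] by linarith
  qed
  then show ?thesis
    unfolding bounded_def by blast
qed

theorem theorem1:
  fixes C D :: "(real ^ 'n) set"
    and F :: "real \<Rightarrow> real ^ 'n \<Rightarrow> (real ^ 'n) set"
    and G :: "real ^ 'n \<Rightarrow> (real ^ 'n) set"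
    and t0 :: real
  assumes "t0 \<ge> 0"
    and "assumption_A t0 C D F G"
    and "assumption_B t0 C D F G"
  shows "(\<forall>x \<in> C \<union> D. \<forall>y \<in> C \<union> D. hybrid_dist C D G x y \<ge> 0) \<and>
    continuous_on ((C \<union> D) \<times> (C \<union> D)) (\<lambda>(x, y). hybrid_dist C D G x y) \<and>
    (\<forall>x \<in> C \<union> D. \<forall>y \<in> C \<union> D. hybrid_dist C D G x y = 0 \<longleftrightarrow>
       (\<exists>k1 \<in> {0..min_jumps D G}. \<exists>k2 \<in> {0..min_jumps D G}.
          svm_iter D G k1 {x} \<inter> svm_iter D G k2 {y} \<noteq> {})) \<and>
    (\<forall>x \<in> C \<union> D. \<forall>\<beta>>0. bounded {y \<in> C \<union> D. hybrid_dist C D G x y < \<beta>}) \<and>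
    (\<forall>x \<in> C \<union> D. \<forall>y \<in> C \<union> D. hybrid_dist C D G x y = hybrid_dist C D G y x) \<and>
    closed (hybrid_diagonal C D G)"
proof -
  have CD: "closed C" "closed D" and nonempty: "C \<union> D \<noteq> {}"
    and G: "outer_semicontinuous D G" "svm_locally_bounded D G" "svm_proper D G"
    using assms(2,3) by (simp_all add: assumption_A_def assumption_B_def)
  note infdist = hybrid_dist_eq_infdist[OF nonempty, of G]
  note diag_closed = closed_hybrid_diagonal[OF CD G]
  have "continuous_on ((C \<union> D) \<times> (C \<union> D)) (\<lambda>(x, y). hybrid_dist C D G x y)"
    unfolding infdist case_prod_unfold by (intro continuous_intros)
  moreover have "hybrid_dist C D G x y = 0 \<longleftrightarrow> jump_related D G x y"
    if "x \<in> C \<union> D" "y \<in> C \<union> D" for x y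
    using in_closed_iff_infdist_zero[OF diag_closed hybrid_diagonal_nonempty[OF nonempty],
        of "(x, y)"] that
    by (simp add: infdist hybrid_diagonal_def)
  moreover have "bounded {y \<in> C \<union> D. hybrid_dist C D G x y < \<beta>}" for x \<beta>
    using bounded_hybrid_dist_less[OF nonempty CD(2) G] by (rule bounded_subset) auto
  moreover have "hybrid_dist C D G x y \<ge> 0" for x y
    by (simp add: infdist infdist_nonneg)
  ultimately show ?thesis
    using hybrid_dist_commute[of C D G] diag_closed unfolding jump_related_def by blast
qed

end
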